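(* Let $\Gamma$ be a finitely generated non-abelian free group and $\rho:\Gamma\to\mathrm{SL}_3(\mathbb{R})$ a reducible suspension preserving the hyperplane $P$. If $\rho$ is quasi-isometric, then for every $\gamma\in\Gamma\setminus\{1\}$ the element $\rho_P(\gamma)$ is hyperbolic, i.e. its two eigenvalues are real with distinct moduli.
   Context: A reducible suspension is a representation $\rho:\Gamma\to\mathrm{SL}_3(\mathbb{R})$ preserving a 2-dimensional subspace $P$; $\rho_P(\gamma):=|\det_P(\rho(\gamma))|^{-1/2}\rho(\gamma)|_P\in\mathrm{SL}^{\pm}(P)$, with $P$ given the volume form inherited from $\mathbb{R}^3$. $\rho$ is quasi-isometric if there are $a\ge1,b\ge0$ with $\log\|\rho(\gamma)\|\ge a^{-1}|\gamma|-b$ for all $\gamma$, where $|\cdot|$ is word length for a fixed finite symmetric generating set (equivalently, $\rho$ is a quasi-isometric embedding). *)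

theory Defs
  imports "HOL-Analysis.Analysis" "HOL-Analysis.Cross3"
begin

section \<open>The free group on a finite alphabet 'a, as reduced words\<close>

text \<open>A letter (x, True) stands for the generator x, (x, False) for its inverse.\<close>

type_synonym 'a fword = "('a \<times> bool) list"

fun fg_reduced :: "'a fword \<Rightarrow> bool" where
  "fg_reduced [] = True"
| "fg_reduced [_] = True"
| "fg_reduced ((x,b) # (y,c) # w) = (\<not> (x = y \<and> b \<noteq> c) \<and> fg_reduced ((y,c) # w))"

definition fg_carrier :: "'a fword set" where
  "fg_carrier = {w. fg_reduced w}"

fun fg_cons :: "'a \<times> bool \<Rightarrow> 'a fword \<Rightarrow> 'a fword" where
  "fg_cons l [] = [l]"
| "fg_cons (x,b) ((y,c) # w) = (if x = y \<and> b \<noteq> c then w else (x,b) # (y,c) # w)"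

text \<open>Product of group elements: free reduction of the concatenation.\<close>
definition fg_mult :: "'a fword \<Rightarrow> 'a fword \<Rightarrow> 'a fword" where
  "fg_mult u v = foldr fg_cons u v"

definition fg_inv :: "'a fword \<Rightarrow> 'a fword" where
  "fg_inv w = rev (map (\<lambda>(x,b). (x, \<not> b)) w)"

text \<open>Product of a list of group elements.\<close>
definition fg_prod :: "'a fword list \<Rightarrow> 'a fword" where
  "fg_prod ws = foldr fg_mult ws []"

text \<open>Finite symmetric generating set of the free group.\<close>
definition fin_sym_gen_set :: "'a fword set \<Rightarrow> bool" where
  "fin_sym_gen_set S \<longleftrightarrow> finite S \<and> S \<subseteq> fg_carrier \<and> (\<forall>s\<in>S. fg_inv s \<in> S)
     \<and> (\<forall>g\<in>fg_carrier. \<exists>ws. set ws \<subseteq> S \<and> fg_prod ws = g)"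

text \<open>Word length with respect to the generating set S.\<close>
definition word_length :: "'a fword set \<Rightarrow> 'a fword \<Rightarrow> nat" where
  "word_length S g = (LEAST n. \<exists>ws. length ws = n \<and> set ws \<subseteq> S \<and> fg_prod ws = g)"

section \<open>Representations into SL(3,R)\<close>

definition is_SL3_rep :: "('a fword \<Rightarrow> real^3^3) \<Rightarrow> bool" where
  "is_SL3_rep \<rho> \<longleftrightarrow> (\<forall>g\<in>fg_carrier. det (\<rho> g) = 1)
     \<and> (\<forall>g\<in>fg_carrier. \<forall>h\<in>fg_carrier. \<rho> (fg_mult g h) = \<rho> g ** \<rho> h)"

text \<open>Reducible suspension: preserves a 2-dimensional linear subspace P.\<close>
definition reducible_suspension :: "('a fword \<Rightarrow> real^3^3) \<Rightarrow> (real^3) set \<Rightarrow> bool" where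
  "reducible_suspension \<rho> P \<longleftrightarrow> is_SL3_rep \<rho> \<and> subspace P \<and> dim P = 2
     \<and> (\<forall>g\<in>fg_carrier. \<forall>x\<in>P. \<rho> g *v x \<in> P)"

text \<open>Determinant of the restriction of A to the 2-plane P (w.r.t. the area form on P
  inherited from R^3): the factor by which A scales oriented areas in P.\<close>
definition det_P :: "(real^3) set \<Rightarrow> real^3^3 \<Rightarrow> real" where
  "det_P P A = (THE d. \<forall>u\<in>P. \<forall>v\<in>P. cross3 (A *v u) (A *v v) = d *\<^sub>R cross3 u v)"

text \<open>rho_P(g) = |det_P(rho(g))|^(-1/2) rho(g)|_P, as a map on P.\<close>
definition rho_P :: "('a fword \<Rightarrow> real^3^3) \<Rightarrow> (real^3) set \<Rightarrow> 'a fword \<Rightarrow> real^3 \<Rightarrow> real^3" where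
  "rho_P \<rho> P g x = (inverse (sqrt \<bar>det_P P (\<rho> g)\<bar>)) *\<^sub>R (\<rho> g *v x)"

text \<open>Quasi-isometric: log of the operator norm grows at least linearly in word length.\<close>
definition quasi_isometric :: "'a fword set \<Rightarrow> ('a fword \<Rightarrow> real^3^3) \<Rightarrow> bool" where
  "quasi_isometric S \<rho> \<longleftrightarrow> (\<exists>a b. a \<ge> 1 \<and> b \<ge> 0 \<and>
     (\<forall>g\<in>fg_carrier. ln (onorm (\<lambda>x. \<rho> g *v x)) \<ge> real (word_length S g) / a - b))"

text \<open>A linear map of the 2-plane P is hyperbolic: its two eigenvalues are real with
  distinct moduli (two real eigenvalues of distinct modulus on a 2-dimensional space are
  necessarily all of its eigenvalues).\<close>
definition hyperbolic_on :: "(real^3) set \<Rightarrow> (real^3 \<Rightarrow> real^3) \<Rightarrow> bool" where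
  "hyperbolic_on P f \<longleftrightarrow> (\<exists>l1 l2 u1 u2. u1 \<in> P \<and> u2 \<in> P \<and> u1 \<noteq> 0 \<and> u2 \<noteq> 0 \<and>
     f u1 = l1 *\<^sub>R u1 \<and> f u2 = l2 *\<^sub>R u2 \<and> \<bar>l1\<bar> \<noteq> \<bar>l2\<bar>)"

end

theory Submission
  imports Defs "HOL-Real_Asymp.Real_Asymp"
begin

text \<open>A non-cyclically reduced word is conjugate to a shorter one, and hyperbolicity of \<open>\<rho>\<^sub>P\<close> is
  invariant under conjugation, so it suffices to treat a cyclically reduced \<open>c\<close>. The matrix
  \<open>M = \<rho>(c)\<close> preserves \<open>P\<close> and acts on \<open>\<real>\<^sup>3/P\<close> by a scalar \<open>\<lambda>\<close> with \<open>det\<^sub>P(M) \<lambda> = 1\<close>. If \<open>\<rho>\<^sub>P(c)\<close> is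
  not hyperbolic, both eigenvalues of \<open>M|\<^sub>P\<close> have modulus \<open>|det\<^sub>P(M)|\<^sup>1\<^sup>/\<^sup>2 = |\<lambda>|\<^sup>-\<^sup>1\<^sup>/\<^sup>2\<close>, and by Cayley-Hamilton
  \<open>M\<^sup>k|\<^sub>P\<close> is a Lucas-sequence combination of \<open>M\<close> and \<open>1\<close> of size \<open>O(k |\<lambda>|\<^sup>-\<^sup>k\<^sup>/\<^sup>2)\<close>. Replacing \<open>c\<close> by \<open>c\<^sup>-\<^sup>1\<close>
  we may assume \<open>T\<^sup>2 = |\<lambda>| \<ge> 1\<close>. For a letter \<open>y\<close> different from the last letter of \<open>c\<close>, the reduced
  words \<open>c\<^sup>k y c\<^sup>-\<^sup>k\<close> have length at least \<open>2k + 1\<close>, but \<open>\<rho>(c\<^sup>k y c\<^sup>-\<^sup>k)\<close> has norm \<open>O(k\<^sup>3)\<close>: on \<open>P\<close> the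
  factor \<open>M\<^sup>-\<^sup>k\<close> expands by at most \<open>T\<^sup>k\<close> and \<open>M\<^sup>k\<close> contracts by \<open>T\<^sup>-\<^sup>k\<close>, while in the normal direction the
  factors \<open>T\<^sup>-\<^sup>2\<^sup>k\<close> and \<open>T\<^sup>2\<^sup>k\<close> cancel. This contradicts \<open>log \<parallel>\<rho>(\<gamma>)\<parallel> \<ge> |\<gamma>|/a - b\<close>.\<close>

section \<open>Reduced words\<close>

definition cancels :: "'a \<times> bool \<Rightarrow> 'a \<times> bool \<Rightarrow> bool" where
  "cancels p q \<longleftrightarrow> fst p = fst q \<and> snd p \<noteq> snd q"

definition letter_inv :: "'a \<times> bool \<Rightarrow> 'a \<times> bool" where
  "letter_inv p = (fst p, \<not> snd p)"

lemma letter_inv_inv [simp]: "letter_inv (letter_inv a) = a"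
  by (simp add: letter_inv_def)

lemma fg_reduced_iff_successively: "fg_reduced w \<longleftrightarrow> successively (\<lambda>p q. \<not> cancels p q) w"
  by (induction w rule: fg_reduced.induct) (auto simp: cancels_def)

lemma fg_carrier_iff: "g \<in> fg_carrier \<longleftrightarrow> fg_reduced g"
  by (simp add: fg_carrier_def)

lemma fg_reduced_append_iff:
  "fg_reduced (u @ v) \<longleftrightarrow> fg_reduced u \<and> fg_reduced v \<and>
     (u \<noteq> [] \<longrightarrow> v \<noteq> [] \<longrightarrow> \<not> cancels (last u) (hd v))"
  by (auto simp: fg_reduced_iff_successively successively_append_iff)

lemma fg_reduced_Cons_iff: "fg_reduced (a # w) \<longleftrightarrow> fg_reduced w \<and> (w \<noteq> [] \<longrightarrow> \<not> cancels a (hd w))"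
  by (cases w) (auto simp: fg_reduced_iff_successively)

lemma fg_cons_reduced: "fg_reduced (a # w) \<Longrightarrow> fg_cons a w = a # w"
  by (cases a; cases w) auto

lemma fg_mult_Nil [simp]: "fg_mult [] v = v"
  by (simp add: fg_mult_def)

lemma fg_mult_Cons: "fg_mult (a # u) v = fg_cons a (fg_mult u v)"
  by (simp add: fg_mult_def)

lemma fg_mult_eq_append: "fg_reduced (u @ v) \<Longrightarrow> fg_mult u v = u @ v"
proof (induction u)
  case (Cons a u)
  then have "fg_reduced (u @ v)" by (auto simp: fg_reduced_iff_successively successively_Cons)
  with Cons show ?case by (simp add: fg_mult_Cons fg_cons_reduced)
qed simp

lemma fg_inv_Cons: "fg_inv (a # u) = fg_inv u @ [letter_inv a]"
  by (cases a) (simp add: fg_inv_def letter_inv_def)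

lemma fg_cons_letter_inv: "fg_cons a (letter_inv a # w) = w"
  by (cases a) (simp add: letter_inv_def)

lemma fg_mult_inv_append: "fg_mult u (fg_inv u @ w) = w"
proof (induction u arbitrary: w)
  case (Cons a u)
  have "fg_mult (a # u) (fg_inv (a # u) @ w) = fg_cons a (fg_mult u (fg_inv u @ (letter_inv a # w)))"
    by (simp add: fg_mult_Cons fg_inv_Cons)
  then show ?case by (simp add: Cons.IH fg_cons_letter_inv)
qed (simp add: fg_inv_def)

lemma fg_mult_right_inv: "fg_mult u (fg_inv u) = []"
  using fg_mult_inv_append[of u "[]"] by simp

lemma fg_reduced_inv: "fg_reduced w \<Longrightarrow> fg_reduced (fg_inv w)"
  unfolding fg_reduced_iff_successively fg_inv_def successively_rev successively_map
  by (erule successively_mono) (auto simp: cancels_def)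

lemma length_fg_cons: "length (fg_cons a w) \<le> Suc (length w)"
  by (cases a; cases w) auto

lemma length_fg_mult: "length (fg_mult u v) \<le> length u + length v"
  by (induction u) (auto simp: fg_mult_Cons intro: order_trans[OF length_fg_cons])

lemma length_fg_prod: "length (fg_prod ws) \<le> (\<Sum>w\<leftarrow>ws. length w)"
  by (induction ws) (auto simp: fg_prod_def intro: order_trans[OF length_fg_mult])

lemma length_le_word_length:
  fixes S :: "'a fword set"
  assumes "fin_sym_gen_set S"
  obtains L :: nat where "L \<ge> 1" "\<And>g. g \<in> fg_carrier \<Longrightarrow> length g \<le> L * word_length S g"
proof
  define L where "L = Max (insert 1 (length ` S))"
  have fin: "finite S" using assms by (simp add: fin_sym_gen_set_def)
  then show "L \<ge> 1" by (simp add: L_def)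
  fix g :: "'a fword" assume "g \<in> fg_carrier"
  then have "\<exists>n ws. length ws = n \<and> set ws \<subseteq> S \<and> fg_prod ws = g"
    using assms by (auto simp: fin_sym_gen_set_def)
  from LeastI_ex[OF this] obtain ws where ws: "length ws = word_length S g" "set ws \<subseteq> S" "fg_prod ws = g"
    unfolding word_length_def by blast
  have "length g \<le> (\<Sum>w\<leftarrow>ws. length w)"
    using length_fg_prod ws(3) by blast
  also have "\<dots> \<le> (\<Sum>w\<leftarrow>ws. L)"
    using ws(2) fin by (intro sum_list_mono) (auto simp: L_def)
  finally show "length g \<le> L * word_length S g"
    using ws(1) by (simp add: sum_list_triv mult.commute)
qed

definition word_pow :: "'b list \<Rightarrow> nat \<Rightarrow> 'b list" where
  "word_pow c k = concat (replicate k c)"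

definition cyclically_reduced :: "'a fword \<Rightarrow> bool" where
  "cyclically_reduced c \<longleftrightarrow> c \<noteq> [] \<and> fg_reduced c \<and> \<not> cancels (last c) (hd c)"

lemma word_pow_0 [simp]: "word_pow c 0 = []"
  by (simp add: word_pow_def)

lemma word_pow_Suc: "word_pow c (Suc k) = c @ word_pow c k"
  by (simp add: word_pow_def)

lemma length_word_pow: "length (word_pow c k) = k * length c"
  by (induction k) (auto simp: word_pow_Suc)

lemma hd_last_word_pow:
  "c \<noteq> [] \<Longrightarrow> hd (word_pow c (Suc k)) = hd c \<and> last (word_pow c (Suc k)) = last c"
  by (induction k) (auto simp: word_pow_Suc)

lemma fg_reduced_word_pow: "cyclically_reduced c \<Longrightarrow> fg_reduced (word_pow c k)"
proof (induction k)
  case (Suc k)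
  then show ?case
    using hd_last_word_pow[of c "k - 1"]
    by (cases "k = 0") (auto simp: word_pow_Suc fg_reduced_append_iff cyclically_reduced_def)
qed simp

lemma fg_mult_word_pow: "cyclically_reduced c \<Longrightarrow> fg_mult c (word_pow c k) = word_pow c (Suc k)"
  using fg_reduced_word_pow[of c "Suc k"] by (simp add: word_pow_Suc fg_mult_eq_append)

lemma hd_last_fg_inv: "c \<noteq> [] \<Longrightarrow> hd (fg_inv c) = letter_inv (last c) \<and> last (fg_inv c) = letter_inv (hd c)"
  by (cases c rule: rev_cases) (auto simp: fg_inv_def letter_inv_def case_prod_beta hd_map last_map
      neq_Nil_conv)

lemma cyclically_reduced_inv: "cyclically_reduced c \<Longrightarrow> cyclically_reduced (fg_inv c)"
  using hd_last_fg_inv[of c] fg_reduced_inv[of c]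
  by (auto simp: cyclically_reduced_def cancels_def letter_inv_def fg_inv_def)

definition conj_word :: "'a fword \<Rightarrow> 'a \<Rightarrow> nat \<Rightarrow> 'a fword" where
  "conj_word c y k = word_pow c k @ [(y, True)] @ word_pow (fg_inv c) k"

lemma fg_reduced_conj_word:
  assumes c: "cyclically_reduced c" and y: "y \<noteq> fst (last c)"
  shows "fg_reduced (conj_word c y k)"
proof (cases k)
  case (Suc j)
  have "c \<noteq> []" "fg_inv c \<noteq> []" using c by (auto simp: cyclically_reduced_def fg_inv_def)
  then have "last (word_pow c k) = last c" "hd (word_pow (fg_inv c) k) = letter_inv (last c)"
    "word_pow c k \<noteq> []" "word_pow (fg_inv c) k \<noteq> []"
    using Suc hd_last_word_pow[of c j] hd_last_word_pow[of "fg_inv c" j] hd_last_fg_inv[of c]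
    by (auto simp: word_pow_Suc)
  then show ?thesis
    using y fg_reduced_word_pow[OF c] fg_reduced_word_pow[OF cyclically_reduced_inv[OF c]]
    by (auto simp: conj_word_def fg_reduced_append_iff fg_reduced_Cons_iff cancels_def letter_inv_def)
qed (simp add: conj_word_def)

lemma length_conj_word: "cyclically_reduced c \<Longrightarrow> length (conj_word c y k) \<ge> 2 * k + 1"
  by (cases c) (auto simp: conj_word_def length_word_pow cyclically_reduced_def fg_inv_def)

lemma not_cyclically_reduced_decomp:
  assumes "fg_reduced g" "g \<noteq> []" "\<not> cyclically_reduced g"
  obtains a g' where "g = [a] @ g' @ [letter_inv a]" "g' \<noteq> []" "fg_reduced g'"
proof -
  obtain a r where g: "g = a # r" using assms(2) by (cases g) auto
  have ca: "cancels (last g) a" using assms by (simp add: cyclically_reduced_def g)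
  then have "r \<noteq> []" using g by (auto simp: cancels_def)
  then obtain g' b where r: "r = g' @ [b]" by (cases r rule: rev_cases) auto
  have b: "b = letter_inv a" using ca g r by (cases a; cases b) (auto simp: cancels_def letter_inv_def)
  have "g' \<noteq> []" using assms(1) ca g r b by (cases a) (auto simp: cancels_def letter_inv_def)
  moreover have "fg_reduced g'" using assms(1) g r
    by (auto simp: fg_reduced_iff_successively successively_append_iff successively_Cons)
  ultimately show ?thesis using that g r b by simp
qed

section \<open>Lucas sequences and powers with eigenvalues of equal moduli\<close>

text \<open>For \<open>d \<noteq> 0\<close> this says that the two roots of \<open>x\<^sup>2 - t x + d\<close> have equal moduli.\<close>
definition equal_root_moduli :: "real \<Rightarrow> real \<Rightarrow> bool" where
  "equal_root_moduli t d \<longleftrightarrow> (d > 0 \<and> t\<^sup>2 \<le> 4 * d) \<or> (d < 0 \<and> t = 0)"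

lemma equal_root_moduli_inverse: "equal_root_moduli t d \<Longrightarrow> equal_root_moduli (t / d) (1 / d)"
  by (auto simp: equal_root_moduli_def power_divide divide_simps power2_eq_square)

lemma roots_distinct_moduli:
  assumes "\<not> equal_root_moduli t d" "d \<noteq> 0"
  obtains m1 m2 where "m1\<^sup>2 - t * m1 + d = 0" "m2\<^sup>2 - t * m2 + d = 0" "\<bar>m1\<bar> \<noteq> \<bar>m2\<bar>"
proof -
  define r where "r = sqrt (t\<^sup>2 - 4 * d)"
  have "t\<^sup>2 - 4 * d > 0"
    using assms by (auto simp: equal_root_moduli_def not_le) (smt (verit) zero_le_power2)
  then have r2: "r\<^sup>2 = t\<^sup>2 - 4 * d" and r: "r > 0" by (simp_all add: r_def)
  define m1 m2 where "m1 = (t + r) / 2" and "m2 = (t - r) / 2"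
  have "m1\<^sup>2 - t * m1 + d = 0" "m2\<^sup>2 - t * m2 + d = 0"
    unfolding m1_def m2_def using r2 by (simp_all add: power2_eq_square field_simps)
  moreover have "\<bar>m1\<bar> \<noteq> \<bar>m2\<bar>"
  proof
    assume "\<bar>m1\<bar> = \<bar>m2\<bar>"
    then have "t = 0" using r by (auto simp: abs_eq_iff m1_def m2_def)
    then show False using assms r2 r by (auto simp: equal_root_moduli_def)
  qed
  ultimately show thesis using that by blast
qed

fun lucasU :: "real \<Rightarrow> real \<Rightarrow> nat \<Rightarrow> real" where
  "lucasU t d 0 = 0"
| "lucasU t d (Suc 0) = 1"
| "lucasU t d (Suc (Suc k)) = t * lucasU t d (Suc k) - d * lucasU t d k"

lemma lucasU_identity:
  "(lucasU t d (Suc k))\<^sup>2 - t * lucasU t d (Suc k) * lucasU t d k + d * (lucasU t d k)\<^sup>2 = d ^ k"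
proof (induction k)
  case (Suc k)
  have "(lucasU t d (Suc (Suc k)))\<^sup>2 - t * lucasU t d (Suc (Suc k)) * lucasU t d (Suc k)
      + d * (lucasU t d (Suc k))\<^sup>2
     = d * ((lucasU t d (Suc k))\<^sup>2 - t * lucasU t d (Suc k) * lucasU t d k + d * (lucasU t d k)\<^sup>2)"
    by (simp add: algebra_simps power2_eq_square)
  with Suc show ?case by simp
qed simp

lemma funpow_eq_lucasU:
  fixes f :: "'a::real_vector \<Rightarrow> 'a"
  assumes f: "linear f" and q: "f (f q) = t *\<^sub>R f q - d *\<^sub>R q"
  shows "(f ^^ Suc k) q = lucasU t d (Suc k) *\<^sub>R f q - (d * lucasU t d k) *\<^sub>R q"
proof (induction k)
  case (Suc k)
  have "(f ^^ Suc (Suc k)) q = f (lucasU t d (Suc k) *\<^sub>R f q - (d * lucasU t d k) *\<^sub>R q)"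
    using Suc.IH by (metis comp_apply funpow.simps(2))
  also have "\<dots> = lucasU t d (Suc k) *\<^sub>R f (f q) - (d * lucasU t d k) *\<^sub>R f q"
    by (simp add: linear_diff[OF f] linear_scale[OF f])
  finally show ?case by (simp add: q algebra_simps)
qed simp

lemma linear_funpow:
  fixes f :: "'a::real_vector \<Rightarrow> 'a"
  shows "linear f \<Longrightarrow> linear (f ^^ k)"
proof (induction k)
  case (Suc k) then show ?case using linear_compose[of "f ^^ k" f] by (simp add: o_def)
qed (simp add: linear_iff)

lemma abs_lucasU_Suc_le:
  assumes d: "d > 0" and t: "t\<^sup>2 \<le> 4 * d"
  shows "\<bar>lucasU t d (Suc j)\<bar> \<le> sqrt d * \<bar>lucasU t d j\<bar> + sqrt d ^ j"
proof -
  define s where "s = sqrt d"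
  have s0: "s \<ge> 0" and s2: "s\<^sup>2 = d" using d by (simp_all add: s_def)
  \<comment> \<open>complete the square in the Lucas identity\<close>
  have "(lucasU t d (Suc j) - t/2 * lucasU t d j)\<^sup>2 + (d - t\<^sup>2/4) * (lucasU t d j)\<^sup>2 = (s ^ j)\<^sup>2"
    using lucasU_identity[of t d j] s2 by (simp add: algebra_simps power2_eq_square flip: power_mult_distrib)
  moreover have "(d - t\<^sup>2/4) * (lucasU t d j)\<^sup>2 \<ge> 0" using t by simp
  ultimately have "(lucasU t d (Suc j) - t/2 * lucasU t d j)\<^sup>2 \<le> (s ^ j)\<^sup>2" by linarith
  then have "\<bar>lucasU t d (Suc j) - t/2 * lucasU t d j\<bar> \<le> s ^ j"
    using s0 by (simp add: power2_le_iff_abs_le)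
  moreover have "\<bar>t\<bar> / 2 \<le> s"
    unfolding s_def by (rule real_le_rsqrt) (use t in \<open>simp add: power_divide\<close>)
  then have "\<bar>t/2 * lucasU t d j\<bar> \<le> s * \<bar>lucasU t d j\<bar>"
    unfolding abs_mult by (intro mult_right_mono) auto
  ultimately show ?thesis unfolding s_def by linarith
qed

lemma abs_lucasU_le:
  assumes "equal_root_moduli t d"
  shows "\<bar>lucasU t d (Suc k)\<bar> \<le> real (Suc k) * sqrt \<bar>d\<bar> ^ k"
proof (cases "d > 0")
  case True
  then have t: "t\<^sup>2 \<le> 4 * d" using assms by (auto simp: equal_root_moduli_def)
  show ?thesis
  proof (induction k)
    case (Suc k)
    have "\<bar>lucasU t d (Suc (Suc k))\<bar> \<le> sqrt d * \<bar>lucasU t d (Suc k)\<bar> + sqrt d ^ Suc k"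
      by (rule abs_lucasU_Suc_le[OF True t])
    also have "\<dots> \<le> sqrt d * (real (Suc k) * sqrt d ^ k) + sqrt d ^ Suc k"
      using Suc True by (simp add: mult_left_mono)
    finally show ?case using True by (simp add: algebra_simps)
  qed simp
next
  case False
  then have d: "d < 0" "t = 0" using assms by (auto simp: equal_root_moduli_def)
  define s where "s = sqrt \<bar>d\<bar>"
  have s: "s \<ge> 0" "s\<^sup>2 = \<bar>d\<bar>" by (simp_all add: s_def)
  \<comment> \<open>here \<open>U\<^sub>k\<close> vanishes for even \<open>k\<close> and is \<open>(-d)\<^sup>(\<^sup>k\<^sup>-\<^sup>1\<^sup>)\<^sup>/\<^sup>2\<close> for odd \<open>k\<close>\<close>
  have "\<bar>lucasU t d (Suc j)\<bar> \<le> s ^ j \<and> \<bar>lucasU t d (Suc (Suc j))\<bar> \<le> s ^ Suc j" for j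
  proof (induction j)
    case (Suc j)
    have "lucasU t d (Suc (Suc (Suc j))) = - d * lucasU t d (Suc j)" using d by simp
    then have "\<bar>lucasU t d (Suc (Suc (Suc j)))\<bar> = s\<^sup>2 * \<bar>lucasU t d (Suc j)\<bar>"
      using s d by (simp add: abs_mult)
    also have "\<dots> \<le> s\<^sup>2 * s ^ j" using Suc by (simp add: mult_left_mono)
    finally show ?case using Suc by (simp add: power_add[symmetric] algebra_simps)
  qed (use d s in simp)
  then have "\<bar>lucasU t d (Suc k)\<bar> \<le> s ^ k" by blast
  also have "\<dots> \<le> real (Suc k) * s ^ k" using s by (simp add: algebra_simps)
  finally show ?thesis by (simp add: s_def)
qed

definition pow_growth_le :: "('a::real_normed_vector \<Rightarrow> 'a) \<Rightarrow> 'a set \<Rightarrow> real \<Rightarrow> real \<Rightarrow> bool" where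
  "pow_growth_le f A K s \<longleftrightarrow> (\<forall>k. \<forall>q\<in>A. norm ((f ^^ k) q) \<le> K * real (k + 1) * s ^ k * norm q)"

lemma pow_growth_le_mono:
  assumes "pow_growth_le f A K s" "K \<le> K'" "s \<ge> 0"
  shows "pow_growth_le f A K' s"
  using assms unfolding pow_growth_le_def by (meson mult_right_mono order_trans zero_le_power of_nat_0_le_iff norm_ge_zero)

lemma norm_funpow_Suc_le:
  fixes f :: "'a::real_normed_vector \<Rightarrow> 'a"
  assumes f: "linear f" and q: "f (f q) = t *\<^sub>R f q - d *\<^sub>R q" and td: "equal_root_moduli t d"
  shows "norm ((f ^^ Suc j) q) \<le> real (Suc j) * sqrt \<bar>d\<bar> ^ j * norm (f q) + real j * sqrt \<bar>d\<bar> ^ Suc j * norm q"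
proof -
  define s where "s = sqrt \<bar>d\<bar>"
  have s: "s \<ge> 0" "s\<^sup>2 = \<bar>d\<bar>" by (simp_all add: s_def)
  have U1: "\<bar>lucasU t d (Suc j)\<bar> \<le> real (Suc j) * s ^ j"
    using abs_lucasU_le[OF td] by (simp add: s_def)
  have U0: "\<bar>d\<bar> * \<bar>lucasU t d j\<bar> \<le> real j * s ^ Suc j"
  proof (cases j)
    case (Suc i)
    have "\<bar>d\<bar> * \<bar>lucasU t d j\<bar> \<le> s\<^sup>2 * (real j * s ^ i)"
      using abs_lucasU_le[OF td, of i] Suc s by (simp add: s_def mult_left_mono)
    then show ?thesis using Suc by (simp add: algebra_simps power2_eq_square)
  qed simp
  have "norm ((f ^^ Suc j) q) = norm (lucasU t d (Suc j) *\<^sub>R f q - (d * lucasU t d j) *\<^sub>R q)"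
    using funpow_eq_lucasU[OF f q] by simp
  also have "\<dots> \<le> \<bar>lucasU t d (Suc j)\<bar> * norm (f q) + (\<bar>d\<bar> * \<bar>lucasU t d j\<bar>) * norm q"
    by (rule order_trans[OF norm_triangle_ineq4]) (simp add: abs_mult)
  also have "\<dots> \<le> real (Suc j) * s ^ j * norm (f q) + real j * s ^ Suc j * norm q"
    using U1 U0 by (intro add_mono mult_right_mono) auto
  finally show ?thesis by (simp add: s_def)
qed

lemma pow_growth_le_lucasU:
  fixes f :: "'a::real_normed_vector \<Rightarrow> 'a"
  assumes f: "bounded_linear f" and ch: "\<And>q. q \<in> A \<Longrightarrow> f (f q) = t *\<^sub>R f q - d *\<^sub>R q"
    and td: "equal_root_moduli t d"
  shows "\<exists>K>0. pow_growth_le f A K (sqrt \<bar>d\<bar>)"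
proof -
  define s where "s = sqrt \<bar>d\<bar>"
  have s: "s > 0" using td by (auto simp: s_def equal_root_moduli_def)
  define B where "B = onorm f"
  have B0: "B \<ge> 0" and Bx: "\<And>x. norm (f x) \<le> B * norm x"
    unfolding B_def using f by (simp_all add: onorm_pos_le onorm)
  define K where "K = B / s + 1"
  have K1: "K \<ge> 1" using B0 s by (simp add: K_def)
  have "norm ((f ^^ k) q) \<le> K * real (k + 1) * s ^ k * norm q" if q: "q \<in> A" for k q
  proof (cases k)
    case (Suc j)
    have "norm ((f ^^ k) q) \<le> real (Suc j) * s ^ j * norm (f q) + real j * s ^ Suc j * norm q"
      using norm_funpow_Suc_le[OF bounded_linear.linear[OF f] ch[OF q] td, of j] Suc by (simp add: s_def)
    also have "\<dots> \<le> real (Suc j) * s ^ j * (B * norm q) + real j * s ^ Suc j * norm q"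
      using Bx[of q] s by (intro add_mono mult_left_mono) auto
    also have "\<dots> = s ^ Suc j * norm q * (real (Suc j) * (B / s) + real j)"
      using s by (simp add: field_simps)
    also have "\<dots> \<le> s ^ Suc j * norm q * (K * real (Suc j + 1))"
    proof (rule mult_left_mono)
      have "K * real (Suc j + 1) = real (Suc j) * (B / s) + B / s + real j + 2"
        by (simp add: K_def algebra_simps)
      then show "real (Suc j) * (B / s) + real j \<le> K * real (Suc j + 1)"
        using B0 s by simp
    qed (use s in simp)
    finally show ?thesis using Suc by (simp add: algebra_simps)
  qed (use K1 in \<open>simp add: mult_le_cancel_right1\<close>)
  then show ?thesis using K1 unfolding pow_growth_le_def s_def by (intro exI[of _ K]) auto
qed

section \<open>Linear maps preserving a plane in \<open>\<real>\<^sup>3\<close>\<close>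

locale orthonormal_plane =
  fixes P :: "(real^3) set" and u1 u2 :: "real^3"
  assumes subspace_P: "subspace P" and u1_in_P: "u1 \<in> P" and u2_in_P: "u2 \<in> P"
    and norm_u1: "norm u1 = 1" and norm_u2: "norm u2 = 1" and inner_u1_u2: "u1 \<bullet> u2 = 0"
    and span_u1_u2: "span {u1, u2} = P"
begin

definition normal :: "real^3" where "normal = cross3 u1 u2"

lemma inner_u1_u1: "u1 \<bullet> u1 = 1" and inner_u2_u2: "u2 \<bullet> u2 = 1" and inner_u2_u1: "u2 \<bullet> u1 = 0"
  using norm_u1 norm_u2 inner_u1_u2 by (simp_all add: norm_eq_sqrt_inner inner_commute)

lemma norm_normal: "norm normal = 1"
proof -
  have "(norm normal)\<^sup>2 = 1"
    using norm_cross_dot[of u1 u2] norm_u1 norm_u2 inner_u1_u2 unfolding normal_def by simp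
  then show ?thesis using norm_ge_zero[of normal] by (simp add: power2_eq_1_iff)
qed

lemma inner_normal_normal: "normal \<bullet> normal = 1"
  using norm_normal by (simp add: norm_eq_sqrt_inner)

lemma normal_nonzero: "normal \<noteq> 0"
  using norm_normal by auto

lemma P_eq_normal_orthogonal: "P = {x. normal \<bullet> x = 0}"
proof (rule subspace_dim_equal)
  have "span {u1, u2} \<subseteq> {x. normal \<bullet> x = 0}"
    by (rule span_minimal) (auto simp: normal_def dot_cross_self subspace_hyperplane)
  then show "P \<subseteq> {x. normal \<bullet> x = 0}" using span_u1_u2 by simp
  have "independent {u1, u2}"
    using inner_u1_u2 norm_u1 norm_u2
    by (intro pairwise_orthogonal_independent) (auto simp: pairwise_def orthogonal_def inner_u2_u1)
  moreover have "u1 \<noteq> u2" using inner_u1_u2 inner_u1_u1 by auto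
  ultimately have "dim P = 2" using span_u1_u2 dim_span[of "{u1, u2}"]
    by (simp add: dim_eq_card_independent)
  then show "dim {x. normal \<bullet> x = 0} \<le> dim P" using dim_hyperplane[OF normal_nonzero] by simp
qed (simp_all add: subspace_P subspace_hyperplane)

lemma in_P_iff: "x \<in> P \<longleftrightarrow> normal \<bullet> x = 0"
  using P_eq_normal_orthogonal by auto

definition proj_P :: "real^3 \<Rightarrow> real^3" where
  "proj_P x = x - (normal \<bullet> x) *\<^sub>R normal"

lemma proj_P_in_P: "proj_P x \<in> P"
  by (simp add: proj_P_def in_P_iff inner_diff_right inner_normal_normal)

lemma proj_P_eq_self: "x \<in> P \<Longrightarrow> proj_P x = x"
  by (simp add: proj_P_def in_P_iff)

lemma proj_P_add: "proj_P (x + y) = proj_P x + proj_P y"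
  and proj_P_scale: "proj_P (c *\<^sub>R x) = c *\<^sub>R proj_P x"
  by (simp_all add: proj_P_def inner_add_right algebra_simps)

lemma proj_P_decomp: "x = proj_P x + (normal \<bullet> x) *\<^sub>R normal"
  by (simp add: proj_P_def)

lemma abs_inner_normal_le: "\<bar>normal \<bullet> x\<bar> \<le> norm x"
  using Cauchy_Schwarz_ineq2[of normal x] norm_normal by simp

lemma norm_proj_P_le: "norm (proj_P x) \<le> norm x"
proof -
  have "proj_P x \<bullet> ((normal \<bullet> x) *\<^sub>R normal) = 0"
    using proj_P_in_P[of x] by (simp add: in_P_iff inner_commute)
  then have "(norm x)\<^sup>2 = (norm (proj_P x))\<^sup>2 + (norm ((normal \<bullet> x) *\<^sub>R normal))\<^sup>2"
    by (subst (1) proj_P_decomp) (simp add: norm_add_Pythagorean orthogonal_def)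
  then have "(norm (proj_P x))\<^sup>2 \<le> (norm x)\<^sup>2" by simp
  then show ?thesis by (simp add: power2_le_iff_abs_le)
qed

lemma P_coords: "x \<in> P \<Longrightarrow> x = (x \<bullet> u1) *\<^sub>R u1 + (x \<bullet> u2) *\<^sub>R u2"
proof -
  assume "x \<in> P"
  define y where "y = x - (x \<bullet> u1) *\<^sub>R u1 - (x \<bullet> u2) *\<^sub>R u2"
  have "y \<in> P" unfolding y_def using \<open>x \<in> P\<close> u1_in_P u2_in_P subspace_P
    by (intro subspace_diff subspace_scale) auto
  have "y \<bullet> u1 = 0" "y \<bullet> u2 = 0"
    by (auto simp: y_def inner_diff_left inner_u1_u1 inner_u2_u2 inner_u2_u1 inner_u1_u2)
  then have "{u1, u2} \<subseteq> {z. y \<bullet> z = 0}" by auto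
  then have "P \<subseteq> {z. y \<bullet> z = 0}"
    using span_minimal[OF _ subspace_hyperplane] span_u1_u2 by blast
  then have "y = 0" using \<open>y \<in> P\<close> by auto
  then show ?thesis unfolding y_def by (simp only: diff_diff_eq right_minus_eq)
qed

lemma comb_in_P: "s *\<^sub>R u1 + t *\<^sub>R u2 \<in> P"
  using u1_in_P u2_in_P subspace_P by (intro subspace_add subspace_scale) auto

lemma comb_eq_iff: "s *\<^sub>R u1 + t *\<^sub>R u2 = s' *\<^sub>R u1 + t' *\<^sub>R u2 \<longleftrightarrow> s = s' \<and> t = t'"
proof -
  have "(s *\<^sub>R u1 + t *\<^sub>R u2) \<bullet> u1 = s" "(s *\<^sub>R u1 + t *\<^sub>R u2) \<bullet> u2 = t" for s t
    by (simp_all add: inner_add_left inner_u1_u1 inner_u2_u1 inner_u2_u2 inner_u1_u2)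
  then show ?thesis by metis
qed

lemma cross3_comb:
  "cross3 (a *\<^sub>R u1 + b *\<^sub>R u2) (c *\<^sub>R u1 + d *\<^sub>R u2) = (a * d - b * c) *\<^sub>R normal"
proof -
  have "cross3 (a *\<^sub>R u1 + b *\<^sub>R u2) (c *\<^sub>R u1 + d *\<^sub>R u2)
     = (a * d) *\<^sub>R cross3 u1 u2 + (b * c) *\<^sub>R cross3 u2 u1"
    by (simp only: cross_add_left cross_add_right cross_mult_left cross_mult_right cross_refl
        scaleR_zero_right add_0_left add_0_right scaleR_scaleR mult.commute[of d a] mult.commute[of c b])
      (rule add.commute)
  also have "cross3 u2 u1 = - normal" unfolding normal_def by (metis cross_skew)
  finally show ?thesis by (simp add: normal_def scaleR_diff_left)
qed

definition invariant :: "real^3^3 \<Rightarrow> bool" where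
  "invariant X \<longleftrightarrow> (\<forall>x\<in>P. X *v x \<in> P)"

text \<open>\<open>m\<^sub>i\<^sub>j X\<close> is the \<open>(i, j)\<close> entry of the matrix of \<open>X|\<^sub>P\<close> in the basis \<open>u1, u2\<close>; for invariant \<open>X\<close>,
  \<open>normal_eig X\<close> is the eigenvalue of \<open>X\<close> on \<open>\<real>\<^sup>3/P\<close>.\<close>
definition m11 :: "real^3^3 \<Rightarrow> real" where "m11 X = (X *v u1) \<bullet> u1"
definition m21 :: "real^3^3 \<Rightarrow> real" where "m21 X = (X *v u1) \<bullet> u2"
definition m12 :: "real^3^3 \<Rightarrow> real" where "m12 X = (X *v u2) \<bullet> u1"
definition m22 :: "real^3^3 \<Rightarrow> real" where "m22 X = (X *v u2) \<bullet> u2"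
definition trace_P :: "real^3^3 \<Rightarrow> real" where "trace_P X = m11 X + m22 X"
definition normal_eig :: "real^3^3 \<Rightarrow> real" where "normal_eig X = normal \<bullet> (X *v normal)"

lemma invariant_u1: "invariant X \<Longrightarrow> X *v u1 = m11 X *\<^sub>R u1 + m21 X *\<^sub>R u2"
  using P_coords[of "X *v u1"] u1_in_P by (simp add: invariant_def m11_def m21_def)

lemma invariant_u2: "invariant X \<Longrightarrow> X *v u2 = m12 X *\<^sub>R u1 + m22 X *\<^sub>R u2"
  using P_coords[of "X *v u2"] u2_in_P by (simp add: invariant_def m12_def m22_def)

lemma invariant_comb: "invariant X \<Longrightarrow> X *v (s *\<^sub>R u1 + t *\<^sub>R u2) =
   (s * m11 X + t * m12 X) *\<^sub>R u1 + (s * m21 X + t * m22 X) *\<^sub>R u2"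
  by (simp add: matrix_vector_right_distrib matrix_vector_mult_scaleR invariant_u1 invariant_u2
      algebra_simps)

lemma cross3_invariant_u1_u2:
  "invariant X \<Longrightarrow> cross3 (X *v u1) (X *v u2) = (m11 X * m22 X - m21 X * m12 X) *\<^sub>R normal"
  using cross3_comb[of "m11 X" "m21 X" "m12 X" "m22 X"] by (simp add: invariant_u1 invariant_u2)

lemma det_P_eq:
  assumes "invariant X"
  shows "det_P P X = m11 X * m22 X - m21 X * m12 X"
  unfolding det_P_def
proof (rule the_equality)
  show "\<forall>u\<in>P. \<forall>v\<in>P. cross3 (X *v u) (X *v v) = (m11 X * m22 X - m21 X * m12 X) *\<^sub>R cross3 u v"
  proof (intro ballI)
    fix u v assume u: "u \<in> P" and v: "v \<in> P"
    have "cross3 (X *v (s1 *\<^sub>R u1 + t1 *\<^sub>R u2)) (X *v (s2 *\<^sub>R u1 + t2 *\<^sub>R u2))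
       = (m11 X * m22 X - m21 X * m12 X) *\<^sub>R cross3 (s1 *\<^sub>R u1 + t1 *\<^sub>R u2) (s2 *\<^sub>R u1 + t2 *\<^sub>R u2)"
      for s1 t1 s2 t2
      unfolding invariant_comb[OF assms] cross3_comb scaleR_scaleR
      by (intro arg_cong[where f="\<lambda>r. r *\<^sub>R normal"]) (simp add: algebra_simps)
    then show "cross3 (X *v u) (X *v v) = (m11 X * m22 X - m21 X * m12 X) *\<^sub>R cross3 u v"
      using P_coords[OF u] P_coords[OF v] by metis
  qed
next
  fix d assume "\<forall>u\<in>P. \<forall>v\<in>P. cross3 (X *v u) (X *v v) = d *\<^sub>R cross3 u v"
  then have "cross3 (X *v u1) (X *v u2) = d *\<^sub>R normal" using u1_in_P u2_in_P by (simp add: normal_def)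
  then show "d = m11 X * m22 X - m21 X * m12 X"
    using cross3_invariant_u1_u2[OF assms] normal_nonzero by (metis scaleR_cancel_right)
qed

lemma cayley_hamilton_P:
  assumes "invariant X" "q \<in> P"
  shows "X *v (X *v q) = trace_P X *\<^sub>R (X *v q) - det_P P X *\<^sub>R q"
proof -
  have q: "q = (q \<bullet> u1) *\<^sub>R u1 + (q \<bullet> u2) *\<^sub>R u2" using P_coords[OF assms(2)] .
  show ?thesis
    by (subst (1 2 3) q, unfold invariant_comb[OF assms(1)])
      (simp add: trace_P_def det_P_eq[OF assms(1)] algebra_simps)
qed

lemma det_eq_det_P_mult_normal_eig:
  assumes "invariant X"
  shows "det X = det_P P X * normal_eig X"
proof -
  have "transpose X *v cross3 (X *v u1) (X *v u2) = det X *\<^sub>R normal"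
    using cross_matrix_mult[of X u1 u2] by (simp add: normal_def)
  then have "det_P P X *\<^sub>R (transpose X *v normal) = det X *\<^sub>R normal"
    by (simp add: det_P_eq[OF assms] cross3_invariant_u1_u2[OF assms] matrix_vector_mult_scaleR)
  then have "normal \<bullet> (det_P P X *\<^sub>R (transpose X *v normal)) = normal \<bullet> (det X *\<^sub>R normal)"
    by simp
  then have "det_P P X * (normal \<bullet> (transpose X *v normal)) = det X"
    by (simp add: inner_normal_normal)
  moreover have "normal \<bullet> (transpose X *v normal) = normal_eig X"
    unfolding normal_eig_def transpose_matrix_vector
    by (simp add: inner_commute[of normal "normal v* X"] dot_lmul_matrix)
  ultimately show ?thesis by simp
qed

lemma eigenvector_in_P:
  assumes X: "invariant X" and m: "m\<^sup>2 - trace_P X * m + det_P P X = 0"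
  obtains u where "u \<in> P" "u \<noteq> 0" "X *v u = m *\<^sub>R u"
proof -
  define a b c e where "a = m11 X" "b = m21 X" "c = m12 X" "e = m22 X"
  have ch: "(m - a) * (m - e) = b * c"
    using m by (simp add: a_b_c_e_def trace_P_def det_P_eq[OF X] algebra_simps power2_eq_square)
  \<comment> \<open>a kernel vector of the \<open>2\<times>2\<close> matrix \<open>A - m I\<close>, whose determinant vanishes\<close>
  have "\<exists>x y. (x \<noteq> 0 \<or> y \<noteq> 0) \<and> x * a + y * c = m * x \<and> x * b + y * e = m * y"
  proof (cases "c = 0")
    case False
    then show ?thesis using ch by (intro exI[of _ c] exI[of _ "m - a"]) (auto simp: algebra_simps)
  next
    case c: True
    show ?thesis
    proof (cases "b = 0")
      case False
      then show ?thesis using c ch by (intro exI[of _ "m - e"] exI[of _ b]) (auto simp: algebra_simps)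
    next
      case True
      then have "m = a \<or> m = e" using c ch by simp
      then show ?thesis
      proof
        assume "m = a"
        then show ?thesis using c True by (intro exI[of _ 1] exI[of _ 0]) simp
      next
        assume "m = e"
        then show ?thesis using c True by (intro exI[of _ 0] exI[of _ 1]) simp
      qed
    qed
  qed
  then obtain x y where xy: "x \<noteq> 0 \<or> y \<noteq> 0" "x * a + y * c = m * x" "x * b + y * e = m * y"
    by blast
  show thesis
  proof
    show "x *\<^sub>R u1 + y *\<^sub>R u2 \<in> P" by (rule comb_in_P)
    show "x *\<^sub>R u1 + y *\<^sub>R u2 \<noteq> 0" using xy(1) comb_eq_iff[of x y 0 0] by auto
    show "X *v (x *\<^sub>R u1 + y *\<^sub>R u2) = m *\<^sub>R (x *\<^sub>R u1 + y *\<^sub>R u2)"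
      unfolding invariant_comb[OF X] using xy(2,3) by (simp add: a_b_c_e_def scaleR_add_right)
  qed
qed

lemma equal_root_moduli_if_not_hyperbolic:
  assumes X: "invariant X" and d: "det_P P X \<noteq> 0" and \<sigma>: "\<sigma> \<noteq> 0"
    and "\<not> hyperbolic_on P (\<lambda>x. \<sigma> *\<^sub>R (X *v x))"
  shows "equal_root_moduli (trace_P X) (det_P P X)"
proof (rule ccontr)
  assume "\<not> equal_root_moduli (trace_P X) (det_P P X)"
  then obtain m1 m2 where m: "m1\<^sup>2 - trace_P X * m1 + det_P P X = 0"
    "m2\<^sup>2 - trace_P X * m2 + det_P P X = 0" "\<bar>m1\<bar> \<noteq> \<bar>m2\<bar>"
    using roots_distinct_moduli d by blast
  obtain v1 where "v1 \<in> P" "v1 \<noteq> 0" "X *v v1 = m1 *\<^sub>R v1" using eigenvector_in_P[OF X m(1)] .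
  moreover obtain v2 where "v2 \<in> P" "v2 \<noteq> 0" "X *v v2 = m2 *\<^sub>R v2" using eigenvector_in_P[OF X m(2)] .
  ultimately have "hyperbolic_on P (\<lambda>x. \<sigma> *\<^sub>R (X *v x))"
    unfolding hyperbolic_on_def using m(3) \<sigma>
    by (intro exI[of _ "\<sigma> * m1"] exI[of _ "\<sigma> * m2"] exI[of _ v1] exI[of _ v2]) (simp add: abs_mult)
  with assms(4) show False ..
qed

lemma det_P_trace_P_inverse:
  assumes X: "invariant X" and Y: "invariant Y" and XY: "\<And>x. X *v (Y *v x) = x"
  shows "det_P P X * det_P P Y = 1" "trace_P Y = trace_P X / det_P P X"
proof -
  have "X *v (Y *v u1) = 1 *\<^sub>R u1 + 0 *\<^sub>R u2" "X *v (Y *v u2) = 0 *\<^sub>R u1 + 1 *\<^sub>R u2"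
    using XY by simp_all
  then have e: "m11 Y * m11 X + m21 Y * m12 X = 1" "m11 Y * m21 X + m21 Y * m22 X = 0"
    "m12 Y * m11 X + m22 Y * m12 X = 0" "m12 Y * m21 X + m22 Y * m22 X = 1"
    unfolding invariant_u1[OF Y] invariant_u2[OF Y] invariant_comb[OF X] comb_eq_iff by auto
  have "det_P P X * det_P P Y = (m11 Y * m11 X + m21 Y * m12 X) * (m12 Y * m21 X + m22 Y * m22 X)
      - (m12 Y * m11 X + m22 Y * m12 X) * (m11 Y * m21 X + m21 Y * m22 X)"
    unfolding det_P_eq[OF X] det_P_eq[OF Y] by (simp add: algebra_simps)
  then show dd: "det_P P X * det_P P Y = 1" using e by simp
  have "m11 Y * det_P P X = m22 X * (m11 Y * m11 X + m21 Y * m12 X) - m12 X * (m11 Y * m21 X + m21 Y * m22 X)"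
    unfolding det_P_eq[OF X] by (simp add: algebra_simps)
  then have a: "m11 Y * det_P P X = m22 X" using e by simp
  have "m22 Y * det_P P X = m11 X * (m12 Y * m21 X + m22 Y * m22 X) - m21 X * (m12 Y * m11 X + m22 Y * m12 X)"
    unfolding det_P_eq[OF X] by (simp add: algebra_simps)
  then have "m22 Y * det_P P X = m11 X" using e by simp
  with a have "trace_P Y * det_P P X = trace_P X" by (simp add: trace_P_def algebra_simps)
  moreover have "det_P P X \<noteq> 0" using dd by auto
  ultimately show "trace_P Y = trace_P X / det_P P X" by (simp add: field_simps)
qed

subsection \<open>Growth of powers\<close>

lemma inner_normal_invariant:
  assumes "invariant X"
  shows "normal \<bullet> (X *v x) = normal_eig X * (normal \<bullet> x)"
proof -
  have "X *v x = X *v proj_P x + (normal \<bullet> x) *\<^sub>R (X *v normal)"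
    by (subst proj_P_decomp) (simp add: matrix_vector_right_distrib matrix_vector_mult_scaleR)
  moreover have "normal \<bullet> (X *v proj_P x) = 0"
    using assms proj_P_in_P by (simp add: invariant_def in_P_iff)
  ultimately show ?thesis by (simp add: inner_add_right normal_eig_def)
qed

lemma inner_normal_funpow:
  "invariant X \<Longrightarrow> normal \<bullet> ((*v) X ^^ k) x = normal_eig X ^ k * (normal \<bullet> x)"
  by (induction k) (simp_all add: inner_normal_invariant)

lemma funpow_invariant: "invariant X \<Longrightarrow> q \<in> P \<Longrightarrow> ((*v) X ^^ k) q \<in> P"
  by (induction k) (auto simp: invariant_def)

lemma linear_matrix_funpow: "linear ((*v) (X :: real^3^3) ^^ k)"
  by (rule linear_funpow[OF matrix_vector_mul_linear])

lemma proj_P_linear_invariant: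
  assumes f: "linear f" and fP: "\<And>q. q \<in> P \<Longrightarrow> f q \<in> P"
  shows "proj_P (f v) = f (proj_P v) + (normal \<bullet> v) *\<^sub>R proj_P (f normal)"
proof -
  have "f v = f (proj_P v + (normal \<bullet> v) *\<^sub>R normal)" by (simp flip: proj_P_decomp)
  then show ?thesis
    by (simp add: linear_add[OF f] linear_scale[OF f] proj_P_add proj_P_scale proj_P_eq_self
        fP proj_P_in_P)
qed

lemma norm_proj_funpow_normal_le:
  assumes X: "invariant X" and g: "pow_growth_le ((*v) X) P K a" and K: "K \<ge> 0"
    and ab: "0 \<le> a" "a \<le> b" and b: "1 \<le> b" and l: "\<bar>normal_eig X\<bar> \<le> b"
  shows "norm (proj_P (((*v) X ^^ k) normal)) \<le> K * norm (proj_P (X *v normal)) * real k ^ 2 * b ^ k"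
proof (induction k)
  case 0
  have "proj_P normal = 0" unfolding proj_P_def inner_normal_normal by simp
  then show ?case by simp
next
  case (Suc k)
  define p where "p = proj_P (X *v normal)"
  define w where "w = proj_P (((*v) X ^^ k) normal)"
  have "proj_P (((*v) X ^^ Suc k) normal) = ((*v) X ^^ k) p + normal_eig X *\<^sub>R w"
    using proj_P_linear_invariant[OF linear_matrix_funpow funpow_invariant[OF X], of k "X *v normal"]
    by (simp add: funpow_Suc_right p_def w_def normal_eig_def inner_commute del: funpow.simps)
  then have "norm (proj_P (((*v) X ^^ Suc k) normal)) \<le> norm (((*v) X ^^ k) p) + \<bar>normal_eig X\<bar> * norm w"
    by (metis norm_scaleR norm_triangle_ineq)
  also have "\<dots> \<le> K * real (k + 1) * b ^ Suc k * norm p + b * (K * norm p * real k ^ 2 * b ^ k)"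
  proof (rule add_mono)
    have "a ^ k \<le> b ^ Suc k"
      using ab b power_mono[of a b k] power_increasing[of k "Suc k" b] by linarith
    moreover have "norm (((*v) X ^^ k) p) \<le> K * real (k + 1) * a ^ k * norm p"
      using g proj_P_in_P unfolding pow_growth_le_def p_def by blast
    ultimately show "norm (((*v) X ^^ k) p) \<le> K * real (k + 1) * b ^ Suc k * norm p"
      using K by (smt (verit) mult_left_mono mult_right_mono of_nat_0_le_iff zero_le_mult_iff norm_ge_zero)
    show "\<bar>normal_eig X\<bar> * norm w \<le> b * (K * norm p * real k ^ 2 * b ^ k)"
      using Suc.IH l by (simp add: w_def p_def mult_mono)
  qed
  also have "\<dots> \<le> K * norm p * real (Suc k) ^ 2 * b ^ Suc k"
  proof -
    have "real (k + 1) + real k ^ 2 \<le> real (Suc k) ^ 2" by (simp add: power2_eq_square algebra_simps)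
    then have "(K * norm p * b ^ Suc k) * (real (k + 1) + real k ^ 2) \<le> (K * norm p * b ^ Suc k) * real (Suc k) ^ 2"
      using K b by (intro mult_left_mono) auto
    then show ?thesis by (simp add: algebra_simps)
  qed
  finally show ?case by (simp add: p_def)
qed

lemma norm_proj_funpow_le:
  assumes X: "invariant X" and g: "pow_growth_le ((*v) X) P K a" and K: "K \<ge> 0"
    and ab: "0 \<le> a" "a \<le> b" and b: "1 \<le> b" and l: "\<bar>normal_eig X\<bar> \<le> b"
  obtains C where "C \<ge> 0" "\<And>k x. norm (proj_P (((*v) X ^^ k) x)) \<le> C * real (k + 1) ^ 2 * b ^ k * norm x"
proof
  define C where "C = K + K * norm (proj_P (X *v normal))"
  show "C \<ge> 0" using K by (simp add: C_def)
  fix k x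
  have kk: "real (k + 1) \<le> real (k + 1) ^ 2" "real k ^ 2 \<le> real (k + 1) ^ 2"
    by (simp add: power2_eq_square) (rule power_mono, auto)
  have "a ^ k \<le> b ^ k" using ab by (simp add: power_mono)
  have "proj_P (((*v) X ^^ k) x) = ((*v) X ^^ k) (proj_P x) + (normal \<bullet> x) *\<^sub>R proj_P (((*v) X ^^ k) normal)"
    by (rule proj_P_linear_invariant[OF linear_matrix_funpow funpow_invariant[OF X]])
  then have "norm (proj_P (((*v) X ^^ k) x))
      \<le> norm (((*v) X ^^ k) (proj_P x)) + \<bar>normal \<bullet> x\<bar> * norm (proj_P (((*v) X ^^ k) normal))"
    by (metis norm_scaleR norm_triangle_ineq)
  also have "\<dots> \<le> K * real (k + 1) * a ^ k * norm (proj_P x)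
      + norm x * (K * norm (proj_P (X *v normal)) * real k ^ 2 * b ^ k)"
    using g proj_P_in_P abs_inner_normal_le norm_proj_funpow_normal_le[OF assms]
    unfolding pow_growth_le_def by (intro add_mono mult_mono) auto
  also have "\<dots> \<le> K * real (k + 1) ^ 2 * b ^ k * norm x
      + norm x * (K * norm (proj_P (X *v normal)) * real (k + 1) ^ 2 * b ^ k)"
    using K kk \<open>a ^ k \<le> b ^ k\<close> norm_proj_P_le[of x] ab b
    by (intro add_mono mult_mono mult_left_mono order_refl) auto
  also have "\<dots> = C * real (k + 1) ^ 2 * b ^ k * norm x" by (simp add: C_def algebra_simps)
  finally show "norm (proj_P (((*v) X ^^ k) x)) \<le> C * real (k + 1) ^ 2 * b ^ k * norm x" .
qed

lemma norm_funpow_normal_le: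
  assumes X: "invariant X" and g: "pow_growth_le ((*v) X) P K a" and K: "K \<ge> 0"
    and ab: "0 \<le> a" "a \<le> b" and b: "1 \<le> b" and l: "\<bar>normal_eig X\<bar> \<le> b"
  obtains C where "\<And>k. norm (((*v) X ^^ k) normal) \<le> C * real (k + 1) ^ 2 * b ^ k"
proof
  define C where "C = K * norm (proj_P (X *v normal)) + 1"
  fix k
  have "((*v) X ^^ k) normal = proj_P (((*v) X ^^ k) normal) + normal_eig X ^ k *\<^sub>R normal"
    using proj_P_decomp inner_normal_funpow[OF X, of k normal] by (metis inner_normal_normal mult_1_right)
  then have "norm (((*v) X ^^ k) normal) \<le> norm (proj_P (((*v) X ^^ k) normal)) + \<bar>normal_eig X\<bar> ^ k"
    using norm_normal by (metis mult_1_right norm_scaleR norm_triangle_ineq power_abs)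
  also have "\<dots> \<le> K * norm (proj_P (X *v normal)) * real (k + 1) ^ 2 * b ^ k + real (k + 1) ^ 2 * b ^ k"
  proof (rule add_mono)
    have "real k ^ 2 \<le> real (k + 1) ^ 2" by (rule power_mono) auto
    then show "norm (proj_P (((*v) X ^^ k) normal)) \<le> K * norm (proj_P (X *v normal)) * real (k + 1) ^ 2 * b ^ k"
      using norm_proj_funpow_normal_le[OF assms, of k] K b
      by (smt (verit) mult_left_mono mult_right_mono norm_ge_zero zero_le_mult_iff zero_le_power)
    have "\<bar>normal_eig X\<bar> ^ k \<le> b ^ k" using l by (simp add: power_mono)
    also have "\<dots> \<le> real (k + 1) ^ 2 * b ^ k" using b by (simp add: mult_le_cancel_right1 one_le_power)
    finally show "\<bar>normal_eig X\<bar> ^ k \<le> real (k + 1) ^ 2 * b ^ k" .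
  qed
  also have "\<dots> = C * real (k + 1) ^ 2 * b ^ k" by (simp add: C_def algebra_simps)
  finally show "norm (((*v) X ^^ k) normal) \<le> C * real (k + 1) ^ 2 * b ^ k" .
qed

lemma abs_inner_normal_funpow_le:
  assumes X: "invariant X" and l: "\<bar>normal_eig X\<bar> * c = 1"
  shows "\<bar>normal \<bullet> ((*v) X ^^ k) x\<bar> * c ^ k \<le> norm x"
proof -
  have "\<bar>normal \<bullet> ((*v) X ^^ k) x\<bar> * c ^ k = \<bar>normal \<bullet> x\<bar> * (\<bar>normal_eig X\<bar> * c) ^ k"
    by (simp add: inner_normal_funpow[OF X] abs_mult power_abs power_mult_distrib)
  then show ?thesis using l abs_inner_normal_le by simp
qed

lemma norm_proj_invariant_le:
  assumes "invariant X"
  shows "norm (proj_P (X *v v)) \<le> onorm ((*v) X) * norm (proj_P v) + \<bar>normal \<bullet> v\<bar> * norm (proj_P (X *v normal))"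
proof -
  have "proj_P (X *v v) = X *v proj_P v + (normal \<bullet> v) *\<^sub>R proj_P (X *v normal)"
    using assms by (intro proj_P_linear_invariant) (simp_all add: invariant_def matrix_vector_mul_linear)
  then have "norm (proj_P (X *v v)) \<le> norm (X *v proj_P v) + \<bar>normal \<bullet> v\<bar> * norm (proj_P (X *v normal))"
    by (metis norm_scaleR norm_triangle_ineq)
  also have "norm (X *v proj_P v) \<le> onorm ((*v) X) * norm (proj_P v)"
    by (rule onorm[OF matrix_vector_mul_bounded_linear])
  finally show ?thesis by simp
qed

lemma norm_funpow_le_proj:
  assumes "pow_growth_le ((*v) X) P K s"
  shows "norm (((*v) X ^^ k) w) \<le> K * real (k + 1) * s ^ k * norm (proj_P w) + \<bar>normal \<bullet> w\<bar> * norm (((*v) X ^^ k) normal)"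
proof -
  have "((*v) X ^^ k) w = ((*v) X ^^ k) (proj_P w + (normal \<bullet> w) *\<^sub>R normal)"
    by (simp flip: proj_P_decomp)
  also have "\<dots> = ((*v) X ^^ k) (proj_P w) + (normal \<bullet> w) *\<^sub>R ((*v) X ^^ k) normal"
    by (simp add: linear_add[OF linear_matrix_funpow] linear_scale[OF linear_matrix_funpow])
  finally have "norm (((*v) X ^^ k) w) \<le> norm (((*v) X ^^ k) (proj_P w)) + \<bar>normal \<bullet> w\<bar> * norm (((*v) X ^^ k) normal)"
    by (metis norm_scaleR norm_triangle_ineq)
  also have "norm (((*v) X ^^ k) (proj_P w)) \<le> K * real (k + 1) * s ^ k * norm (proj_P w)"
    using assms proj_P_in_P unfolding pow_growth_le_def by blast
  finally show ?thesis by simp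
qed

text \<open>On \<open>P\<close>, \<open>N\<^sup>k\<close> expands by at most \<open>T\<^sup>k\<close> and \<open>M\<^sup>k\<close> contracts by \<open>T\<^sup>-\<^sup>k\<close>; in the normal direction
  \<open>N\<^sup>k\<close> contracts by \<open>T\<^sup>-\<^sup>2\<^sup>k\<close> and \<open>M\<^sup>k\<close> expands by \<open>T\<^sup>2\<^sup>k\<close>. Only polynomial factors survive.\<close>
lemma norm_conj_funpow_le:
  assumes M: "invariant M" and N: "invariant N" and D: "invariant D" and T: "T \<ge> 1" and K: "K \<ge> 0"
    and gM: "pow_growth_le ((*v) M) P K (1 / T)" and gN: "pow_growth_le ((*v) N) P K T"
    and lM: "\<bar>normal_eig M\<bar> = T\<^sup>2" and lN: "\<bar>normal_eig N\<bar> = 1 / T\<^sup>2"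
  obtains C where "\<And>k x. norm (((*v) M ^^ k) (D *v ((*v) N ^^ k) x)) \<le> C * real (k + 1) ^ 3 * norm x"
proof -
  have T0: "T > 0" using T by simp
  have "0 \<le> T" "1 / T\<^sup>2 \<le> T" using T by (auto, smt (verit) divide_le_eq_1_pos one_le_power T0 zero_less_power)
  then obtain CN where CN: "\<And>k x. norm (proj_P (((*v) N ^^ k) x)) \<le> CN * real (k + 1) ^ 2 * T ^ k * norm x"
    using norm_proj_funpow_le[OF N gN K] T lN by (metis order_refl)
  have "0 \<le> 1 / T" "1 / T \<le> T\<^sup>2" "1 \<le> T\<^sup>2" "\<bar>normal_eig M\<bar> \<le> T\<^sup>2"
    using T lM by (auto simp: one_le_power) (smt (verit) divide_le_eq_1_pos one_le_power T0)
  then obtain CM where CM: "\<And>k. norm (((*v) M ^^ k) normal) \<le> CM * real (k + 1) ^ 2 * (T\<^sup>2) ^ k"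
    using norm_funpow_normal_le[OF M gM K] by blast
  define C0 where "C0 = onorm ((*v) D) * CN + norm (proj_P (D *v normal))"
  show thesis
  proof (rule that[of "K * C0 + \<bar>normal_eig D\<bar> * CM"])
    fix k x
    define v where "v = ((*v) N ^^ k) x"
    have k3: "real (k + 1) ^ 2 \<le> real (k + 1) ^ 3" by (rule power_increasing) auto
    have k1: "1 \<le> real (k + 1) ^ 2 * T ^ k"
      using mult_mono[of 1 "real (k + 1) ^ 2" 1 "T ^ k"] T by (simp add: one_le_power)
    have nv: "\<bar>normal \<bullet> v\<bar> * (T\<^sup>2) ^ k \<le> norm x"
      unfolding v_def using abs_inner_normal_funpow_le[OF N] lN T0 by simp
    then have "\<bar>normal \<bullet> v\<bar> \<le> norm x"
      using mult_left_mono[OF one_le_power[of "T\<^sup>2" k], of "\<bar>normal \<bullet> v\<bar>"] T by (simp add: one_le_power)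
    have "norm (proj_P (D *v v)) \<le> C0 * real (k + 1) ^ 2 * T ^ k * norm x"
    proof -
      have B: "onorm ((*v) D) \<ge> 0" by (rule onorm_pos_le[OF matrix_vector_mul_bounded_linear])
      have "norm (proj_P (D *v v)) \<le> onorm ((*v) D) * norm (proj_P v) + \<bar>normal \<bullet> v\<bar> * norm (proj_P (D *v normal))"
        by (rule norm_proj_invariant_le[OF D])
      also have "\<dots> \<le> onorm ((*v) D) * (CN * real (k + 1) ^ 2 * T ^ k * norm x)
          + (real (k + 1) ^ 2 * T ^ k * norm x) * norm (proj_P (D *v normal))"
        using CN[of k x] B \<open>\<bar>normal \<bullet> v\<bar> \<le> norm x\<close> mult_right_mono[OF k1, of "norm x"]
        unfolding v_def by (intro add_mono mult_left_mono mult_right_mono) auto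
      finally show ?thesis by (simp add: C0_def algebra_simps)
    qed
    then have "K * real (k + 1) * (1 / T) ^ k * norm (proj_P (D *v v))
        \<le> K * real (k + 1) * (1 / T) ^ k * (C0 * real (k + 1) ^ 2 * T ^ k * norm x)"
      using K T0 by (intro mult_left_mono) auto
    also have "\<dots> = K * C0 * real (k + 1) ^ 3 * norm x"
      using T0 by (simp add: power_divide field_simps power3_eq_cube power2_eq_square)
    finally have "K * real (k + 1) * (1 / T) ^ k * norm (proj_P (D *v v)) \<le> K * C0 * real (k + 1) ^ 3 * norm x" .
    moreover have "\<bar>normal \<bullet> (D *v v)\<bar> * norm (((*v) M ^^ k) normal) \<le> \<bar>normal_eig D\<bar> * CM * real (k + 1) ^ 3 * norm x"
    proof -
      have "\<bar>normal \<bullet> (D *v v)\<bar> * norm (((*v) M ^^ k) normal)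
          = \<bar>normal_eig D\<bar> * (\<bar>normal \<bullet> v\<bar> * norm (((*v) M ^^ k) normal))"
        by (simp add: inner_normal_invariant[OF D] abs_mult)
      also have "\<dots> \<le> \<bar>normal_eig D\<bar> * (\<bar>normal \<bullet> v\<bar> * (CM * real (k + 1) ^ 2 * (T\<^sup>2) ^ k))"
        using CM[of k] by (intro mult_left_mono) auto
      also have "\<dots> = \<bar>normal_eig D\<bar> * ((\<bar>normal \<bullet> v\<bar> * (T\<^sup>2) ^ k) * (CM * real (k + 1) ^ 2))"
        by (simp add: algebra_simps)
      also have "\<dots> \<le> \<bar>normal_eig D\<bar> * (norm x * (CM * real (k + 1) ^ 3))"
        using nv k3 CM[of 0] norm_normal by (intro mult_left_mono mult_mono) auto
      finally show ?thesis by (simp add: algebra_simps)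
    qed
    ultimately show "norm (((*v) M ^^ k) (D *v v)) \<le> (K * C0 + \<bar>normal_eig D\<bar> * CM) * real (k + 1) ^ 3 * norm x"
      using norm_funpow_le_proj[OF gM, of k "D *v v"] by (simp add: algebra_simps)
  qed
qed

end

section \<open>Reducible suspensions\<close>

lemma linear_not_le_ln_poly:
  fixes \<alpha> C b :: real
  assumes "\<alpha> > 0" "C > 0"
  shows "\<not> (\<forall>k::nat. \<alpha> * real k - b \<le> ln (C * real (k + 1) ^ n))"
proof -
  have "filterlim (\<lambda>k::nat. \<alpha> * real k - b - ln (C * real (k + 1) ^ n)) at_top at_top"
    using assms by real_asymp
  then have "\<forall>\<^sub>F k in sequentially. \<alpha> * real k - b - ln (C * real (k + 1) ^ n) > 0"
    by (simp only: filterlim_at_top_dense)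
  then obtain k :: nat where "\<alpha> * real k - b - ln (C * real (k + 1) ^ n) > 0"
    by (auto simp: eventually_sequentially)
  then show ?thesis by (metis diff_gt_0_iff_gt not_le)
qed

lemma hyperbolic_on_linear_image:
  assumes f: "hyperbolic_on P f" and A: "linear A" "inj A" "\<And>v. v \<in> P \<Longrightarrow> A v \<in> P"
    and c: "c \<noteq> 0" and g: "\<And>v. v \<in> P \<Longrightarrow> g (A v) = c *\<^sub>R A (f v)"
  shows "hyperbolic_on P g"
proof -
  obtain l1 l2 v1 v2 where v: "v1 \<in> P" "v2 \<in> P" "v1 \<noteq> 0" "v2 \<noteq> 0"
    "f v1 = l1 *\<^sub>R v1" "f v2 = l2 *\<^sub>R v2" "\<bar>l1\<bar> \<noteq> \<bar>l2\<bar>"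
    using f unfolding hyperbolic_on_def by blast
  have "A v1 \<noteq> 0" "A v2 \<noteq> 0"
    using v(3,4) A(2) linear_0[OF A(1)] by (metis injD)+
  moreover have "g (A v1) = (c * l1) *\<^sub>R A v1" "g (A v2) = (c * l2) *\<^sub>R A v2"
    using g v linear_scale[OF A(1)] by simp_all
  moreover have "\<bar>c * l1\<bar> \<noteq> \<bar>c * l2\<bar>" using v(7) c by (simp add: abs_mult)
  ultimately show ?thesis
    unfolding hyperbolic_on_def using v(1,2) A(3) by blast
qed

lemma ex_neq_if_card_ge_2:
  assumes "CARD('a) \<ge> 2"
  shows "\<exists>y::'a. y \<noteq> x"
proof (rule ccontr)
  assume "\<not> (\<exists>y::'a. y \<noteq> x)"
  then have "CARD('a) = card {x}" by (metis UNIV_eq_I singletonI)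
  with assms show False by simp
qed

locale qi_suspension = orthonormal_plane P u1 u2 for P u1 u2 +
  fixes \<rho> :: "('a::finite) fword \<Rightarrow> real^3^3" and S :: "'a fword set"
  assumes card_ge_2: "CARD('a) \<ge> 2" and gen: "fin_sym_gen_set S"
    and susp: "reducible_suspension \<rho> P" and qi: "quasi_isometric S \<rho>"
begin

lemma rho_mult: "g \<in> fg_carrier \<Longrightarrow> h \<in> fg_carrier \<Longrightarrow> \<rho> (fg_mult g h) = \<rho> g ** \<rho> h"
  using susp by (simp add: reducible_suspension_def is_SL3_rep_def)

lemma det_rho: "g \<in> fg_carrier \<Longrightarrow> det (\<rho> g) = 1"
  using susp by (simp add: reducible_suspension_def is_SL3_rep_def)

lemma invariant_rho: "g \<in> fg_carrier \<Longrightarrow> invariant (\<rho> g)"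
  using susp by (simp add: reducible_suspension_def invariant_def)

lemma rho_Nil: "\<rho> [] = mat 1"
proof -
  have Nil: "[] \<in> fg_carrier" by (simp add: fg_carrier_iff)
  define A where "A = \<rho> []"
  have AA: "A ** A = A" using rho_mult[OF Nil Nil] by (simp add: A_def)
  have "invertible A" using det_rho[OF Nil] by (simp add: A_def invertible_det_nz)
  then obtain A' where A': "A ** A' = mat 1" unfolding invertible_def by blast
  have "(A ** A) ** A' = A" by (simp only: matrix_mul_assoc[symmetric] A' matrix_mul_rid)
  then show ?thesis unfolding AA A' by (simp add: A_def)
qed

lemma rho_fg_inv_apply:
  assumes "g \<in> fg_carrier"
  shows "\<rho> g *v (\<rho> (fg_inv g) *v x) = x"
proof -
  have "\<rho> g ** \<rho> (fg_inv g) = mat 1"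
    using rho_mult[OF assms, of "fg_inv g"] assms fg_reduced_inv[of g]
    by (simp add: fg_carrier_iff fg_mult_right_inv rho_Nil)
  then show ?thesis by (simp add: matrix_vector_mul_assoc)
qed

lemma det_P_mult_normal_eig_rho: "g \<in> fg_carrier \<Longrightarrow> det_P P (\<rho> g) * normal_eig (\<rho> g) = 1"
  using det_eq_det_P_mult_normal_eig[OF invariant_rho] det_rho by simp

lemma det_P_rho_nonzero: "g \<in> fg_carrier \<Longrightarrow> det_P P (\<rho> g) \<noteq> 0"
  using det_P_mult_normal_eig_rho by force

lemma rho_fg_inv_invariants:
  assumes g: "g \<in> fg_carrier"
  shows "det_P P (\<rho> (fg_inv g)) = 1 / det_P P (\<rho> g)"
    and "trace_P (\<rho> (fg_inv g)) = trace_P (\<rho> g) / det_P P (\<rho> g)"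
    and "normal_eig (\<rho> (fg_inv g)) = det_P P (\<rho> g)"
    and "normal_eig (\<rho> g) = 1 / det_P P (\<rho> g)"
proof -
  have gi: "fg_inv g \<in> fg_carrier" using g fg_reduced_inv by (simp add: fg_carrier_iff)
  note inv = det_P_trace_P_inverse[OF invariant_rho[OF g] invariant_rho[OF gi] rho_fg_inv_apply[OF g]]
  show d: "det_P P (\<rho> (fg_inv g)) = 1 / det_P P (\<rho> g)"
    using inv(1) det_P_rho_nonzero[OF g] by (simp add: field_simps)
  show "trace_P (\<rho> (fg_inv g)) = trace_P (\<rho> g) / det_P P (\<rho> g)" by (rule inv(2))
  show "normal_eig (\<rho> (fg_inv g)) = det_P P (\<rho> g)"
    using det_P_mult_normal_eig_rho[OF gi] det_P_rho_nonzero[OF g] d by (simp add: field_simps)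
  show "normal_eig (\<rho> g) = 1 / det_P P (\<rho> g)"
    using det_P_mult_normal_eig_rho[OF g] det_P_rho_nonzero[OF g] by (simp add: field_simps)
qed

lemma onorm_rho_pos: "g \<in> fg_carrier \<Longrightarrow> onorm ((*v) (\<rho> g)) > 0"
  using rho_fg_inv_apply[of g "axis 1 1"]
  by (metis onorm_pos_lt[OF matrix_vector_mul_bounded_linear] axis_nth zero_index zero_neq_one)

lemma rho_word_pow:
  assumes "cyclically_reduced c"
  shows "\<rho> (word_pow c k) *v x = ((*v) (\<rho> c) ^^ k) x"
proof (induction k arbitrary: x)
  case (Suc k)
  have "c \<in> fg_carrier" "word_pow c k \<in> fg_carrier"
    using assms fg_reduced_word_pow by (auto simp: cyclically_reduced_def fg_carrier_iff)
  from rho_mult[OF this] have "\<rho> (word_pow c (Suc k)) = \<rho> c ** \<rho> (word_pow c k)"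
    by (simp add: fg_mult_word_pow[OF assms])
  then show ?case using Suc by (simp add: matrix_vector_mul_assoc[symmetric])
qed (simp add: rho_Nil)

lemma rho_conj_word:
  assumes c: "cyclically_reduced c" and y: "y \<noteq> fst (last c)"
  shows "\<rho> (conj_word c y k) *v x
    = ((*v) (\<rho> c) ^^ k) (\<rho> [(y, True)] *v ((*v) (\<rho> (fg_inv c)) ^^ k) x)"
proof -
  have ci: "cyclically_reduced (fg_inv c)" by (rule cyclically_reduced_inv[OF c])
  have r: "fg_reduced ([(y, True)] @ word_pow (fg_inv c) k)"
    using fg_reduced_conj_word[OF c y, of k] by (simp add: conj_word_def fg_reduced_append_iff)
  then have "conj_word c y k = fg_mult (word_pow c k) (fg_mult [(y, True)] (word_pow (fg_inv c) k))"
    using fg_reduced_conj_word[OF c y, of k] by (simp add: conj_word_def fg_mult_eq_append)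
  moreover have "word_pow c k \<in> fg_carrier" "word_pow (fg_inv c) k \<in> fg_carrier"
    "[(y, True)] \<in> fg_carrier" "fg_mult [(y, True)] (word_pow (fg_inv c) k) \<in> fg_carrier"
    using fg_reduced_word_pow[OF c] fg_reduced_word_pow[OF ci] r fg_mult_eq_append[OF r]
    by (simp_all add: fg_carrier_iff)
  ultimately have "\<rho> (conj_word c y k) = \<rho> (word_pow c k) ** (\<rho> [(y, True)] ** \<rho> (word_pow (fg_inv c) k))"
    by (simp add: rho_mult)
  then show ?thesis
    by (simp add: matrix_vector_mul_assoc[symmetric] rho_word_pow[OF c] rho_word_pow[OF ci])
qed

lemma onorm_rho_conj_word_le:
  assumes c: "cyclically_reduced c" and y: "y \<noteq> fst (last c)"
    and eq: "equal_root_moduli (trace_P (\<rho> c)) (det_P P (\<rho> c))" and l: "\<bar>normal_eig (\<rho> c)\<bar> \<ge> 1"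
  obtains C where "\<And>k. onorm ((*v) (\<rho> (conj_word c y k))) \<le> C * real (k + 1) ^ 3"
proof -
  have cC: "c \<in> fg_carrier" using c by (simp add: cyclically_reduced_def fg_carrier_iff)
  have cI: "fg_inv c \<in> fg_carrier" using cC fg_reduced_inv by (simp add: fg_carrier_iff)
  define M N D where "M = \<rho> c" and "N = \<rho> (fg_inv c)" and "D = \<rho> [(y, True)]"
  have inv: "invariant M" "invariant N" "invariant D"
    using invariant_rho cC cI by (auto simp: M_def N_def D_def fg_carrier_iff)
  define T where "T = sqrt \<bar>normal_eig M\<bar>"
  have T: "T \<ge> 1" using l by (simp add: T_def M_def)
  have lM: "\<bar>normal_eig M\<bar> = T\<^sup>2" by (simp add: T_def)
  note MN = rho_fg_inv_invariants[OF cC, folded M_def N_def]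
  have T2: "T\<^sup>2 = 1 / \<bar>det_P P M\<bar>" by (simp add: T_def MN abs_divide)
  have lN: "\<bar>normal_eig N\<bar> = 1 / T\<^sup>2" using det_P_rho_nonzero[OF cC] by (simp add: MN T2 M_def)
  have dM: "sqrt \<bar>det_P P M\<bar> = 1 / T" and dN: "sqrt \<bar>det_P P N\<bar> = T"
    by (simp_all add: T_def MN abs_divide real_sqrt_divide)
  have eqN: "equal_root_moduli (trace_P N) (det_P P N)"
    using equal_root_moduli_inverse[OF eq[folded M_def]] MN by simp
  obtain KM where KM: "KM > 0" "pow_growth_le ((*v) M) P KM (1 / T)"
    using pow_growth_le_lucasU[OF matrix_vector_mul_bounded_linear cayley_hamilton_P[OF inv(1)]]
      eq dM by (auto simp: M_def)
  obtain KN where KN: "KN > 0" "pow_growth_le ((*v) N) P KN T"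
    using pow_growth_le_lucasU[OF matrix_vector_mul_bounded_linear cayley_hamilton_P[OF inv(2)] eqN]
      dN by auto
  have K: "max KM KN \<ge> 0" using KM by (auto simp: max_def)
  have "pow_growth_le ((*v) M) P (max KM KN) (1 / T)" "pow_growth_le ((*v) N) P (max KM KN) T"
    using KM KN T by (auto intro: pow_growth_le_mono)
  then obtain C where C: "\<And>k x. norm (((*v) M ^^ k) (D *v ((*v) N ^^ k) x)) \<le> C * real (k + 1) ^ 3 * norm x"
    using norm_conj_funpow_le[OF inv T K _ _ lM lN] by blast
  show thesis
    by (rule that[of C], rule onorm_le) (use C in \<open>simp add: rho_conj_word[OF c y] M_def N_def D_def\<close>)
qed

lemma ln_onorm_rho_conj_word_ge:
  assumes c: "cyclically_reduced c" and y: "y \<noteq> fst (last c)"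
  obtains \<alpha> \<beta> where "\<alpha> > 0" "\<And>k. \<alpha> * real k - \<beta> \<le> ln (onorm ((*v) (\<rho> (conj_word c y k))))"
proof -
  obtain a b where ab: "a \<ge> 1"
    "\<And>g. g \<in> fg_carrier \<Longrightarrow> real (word_length S g) / a - b \<le> ln (onorm ((*v) (\<rho> g)))"
    using qi unfolding quasi_isometric_def by blast
  obtain L :: nat where L: "L \<ge> 1" "\<And>g. g \<in> fg_carrier \<Longrightarrow> length g \<le> L * word_length S g"
    using length_le_word_length[OF gen] by blast
  show thesis
  proof (rule that[of "1 / (L * a)" b])
    show "1 / (L * a) > 0" using L ab by simp
    fix k
    have h: "conj_word c y k \<in> fg_carrier" using fg_reduced_conj_word[OF c y] by (simp add: fg_carrier_iff)
    have "k \<le> L * word_length S (conj_word c y k)"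
      using length_conj_word[OF c, where y=y and k=k] L(2)[OF h] by linarith
    then have "real k \<le> real L * real (word_length S (conj_word c y k))" by (metis of_nat_le_iff of_nat_mult)
    then have "1 / (L * a) * real k \<le> real (word_length S (conj_word c y k)) / a"
      using L ab by (simp add: field_simps)
    then show "1 / (L * a) * real k - b \<le> ln (onorm ((*v) (\<rho> (conj_word c y k))))"
      using ab(2)[OF h] by linarith
  qed
qed

lemma not_equal_root_moduli_if_normal_expanding:
  assumes c: "cyclically_reduced c" and l: "\<bar>normal_eig (\<rho> c)\<bar> \<ge> 1"
  shows "\<not> equal_root_moduli (trace_P (\<rho> c)) (det_P P (\<rho> c))"
proof
  assume eq: "equal_root_moduli (trace_P (\<rho> c)) (det_P P (\<rho> c))"
  obtain y where y: "y \<noteq> fst (last c)" using ex_neq_if_card_ge_2[OF card_ge_2] by blast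
  obtain C where C: "\<And>k. onorm ((*v) (\<rho> (conj_word c y k))) \<le> C * real (k + 1) ^ 3"
    using onorm_rho_conj_word_le[OF c y eq l] by blast
  obtain \<alpha> \<beta> where \<alpha>: "\<alpha> > 0" "\<And>k. \<alpha> * real k - \<beta> \<le> ln (onorm ((*v) (\<rho> (conj_word c y k))))"
    using ln_onorm_rho_conj_word_ge[OF c y] by blast
  have pos: "onorm ((*v) (\<rho> (conj_word c y k))) > 0" for k
    using onorm_rho_pos fg_reduced_conj_word[OF c y] by (simp add: fg_carrier_iff)
  have "C > 0" using C[of 0] pos[of 0] by simp
  have "\<alpha> * real k - \<beta> \<le> ln (C * real (k + 1) ^ 3)" for k
  proof -
    have "ln (onorm ((*v) (\<rho> (conj_word c y k)))) \<le> ln (C * real (k + 1) ^ 3)"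
      using C[of k] pos[of k] by (metis ln_le_cancel_iff order_less_le_trans)
    then show ?thesis using \<alpha>(2)[of k] by linarith
  qed
  then show False using linear_not_le_ln_poly[OF \<alpha>(1) \<open>C > 0\<close>] by blast
qed

lemma hyperbolic_rho_P_cyclically_reduced:
  assumes c: "cyclically_reduced c"
  shows "hyperbolic_on P (rho_P \<rho> P c)"
proof (rule ccontr)
  assume nh: "\<not> hyperbolic_on P (rho_P \<rho> P c)"
  have cC: "c \<in> fg_carrier" using c by (simp add: cyclically_reduced_def fg_carrier_iff)
  have d: "det_P P (\<rho> c) \<noteq> 0" by (rule det_P_rho_nonzero[OF cC])
  have eq: "equal_root_moduli (trace_P (\<rho> c)) (det_P P (\<rho> c))"
    using equal_root_moduli_if_not_hyperbolic[OF invariant_rho[OF cC] d, of "inverse (sqrt \<bar>det_P P (\<rho> c)\<bar>)"] nh d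
    unfolding rho_P_def[abs_def] by simp
  note inv = rho_fg_inv_invariants[OF cC]
  show False
  proof (cases "\<bar>normal_eig (\<rho> c)\<bar> \<ge> 1")
    case True
    then show False using not_equal_root_moduli_if_normal_expanding[OF c] eq by blast
  next
    case False
    then have "\<bar>normal_eig (\<rho> (fg_inv c))\<bar> \<ge> 1"
      using inv(3,4) d by (simp add: abs_divide)
    moreover have "equal_root_moduli (trace_P (\<rho> (fg_inv c))) (det_P P (\<rho> (fg_inv c)))"
      using equal_root_moduli_inverse[OF eq] inv(1,2) by simp
    ultimately show False
      using not_equal_root_moduli_if_normal_expanding[OF cyclically_reduced_inv[OF c]] by blast
  qed
qed

lemma hyperbolic_rho_P_conj:
  assumes g: "g = [a] @ g' @ [letter_inv a]" and rg: "fg_reduced g" and rg': "fg_reduced g'"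
    and hyp: "hyperbolic_on P (rho_P \<rho> P g')"
  shows "hyperbolic_on P (rho_P \<rho> P g)"
proof -
  have r1: "fg_reduced (g' @ [letter_inv a])" using rg g by (simp add: fg_reduced_Cons_iff)
  have gm: "g = fg_mult [a] (fg_mult g' [letter_inv a])"
    using rg g by (simp add: fg_mult_eq_append[OF r1] fg_mult_eq_append)
  have cs: "[a] \<in> fg_carrier" "[letter_inv a] \<in> fg_carrier" "g' \<in> fg_carrier"
    "fg_mult g' [letter_inv a] \<in> fg_carrier" "g \<in> fg_carrier"
    using rg' r1 rg by (simp_all add: fg_carrier_iff fg_mult_eq_append[OF r1])
  define A where "A = \<rho> [a]"
  have "fg_mult [letter_inv a] [a] = []"
    using fg_cons_letter_inv[of "letter_inv a" "[]"] by (simp add: fg_mult_Cons)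
  then have "\<rho> [letter_inv a] ** A = mat 1"
    using rho_mult[OF cs(2,1)] by (simp add: A_def rho_Nil)
  then have A_inv: "\<rho> [letter_inv a] *v (A *v v) = v" for v by (simp add: matrix_vector_mul_assoc)
  then have "inj ((*v) A)" by (metis injI)
  have "\<rho> g = A ** (\<rho> g' ** \<rho> [letter_inv a])"
    using gm rho_mult[OF cs(1,4)] rho_mult[OF cs(3,2)] by (simp add: A_def)
  then have conj: "\<rho> g *v (A *v v) = A *v (\<rho> g' *v v)" for v
    by (simp add: matrix_vector_mul_assoc[symmetric] A_inv)
  define \<sigma> \<sigma>' where "\<sigma> = inverse (sqrt \<bar>det_P P (\<rho> g)\<bar>)" and "\<sigma>' = inverse (sqrt \<bar>det_P P (\<rho> g')\<bar>)"
  have "\<sigma>' \<noteq> 0" using det_P_rho_nonzero[OF cs(3)] by (simp add: \<sigma>'_def)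
  show ?thesis
  proof (rule hyperbolic_on_linear_image[OF hyp matrix_vector_mul_linear \<open>inj ((*v) A)\<close>])
    show "A *v v \<in> P" if "v \<in> P" for v using invariant_rho[OF cs(1)] that by (simp add: invariant_def A_def)
    show "\<sigma> / \<sigma>' \<noteq> 0" using det_P_rho_nonzero[OF cs(5)] \<open>\<sigma>' \<noteq> 0\<close> by (simp add: \<sigma>_def)
    show "rho_P \<rho> P g (A *v v) = (\<sigma> / \<sigma>') *\<^sub>R (A *v rho_P \<rho> P g' v)" for v
      using \<open>\<sigma>' \<noteq> 0\<close> by (simp add: rho_P_def conj \<sigma>_def[symmetric] \<sigma>'_def[symmetric] matrix_vector_mult_scaleR)
  qed
qed

lemma hyperbolic_rho_P: "fg_reduced g \<Longrightarrow> g \<noteq> [] \<Longrightarrow> hyperbolic_on P (rho_P \<rho> P g)"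
proof (induction "length g" arbitrary: g rule: less_induct)
  case less
  show ?case
  proof (cases "cyclically_reduced g")
    case True
    then show ?thesis by (rule hyperbolic_rho_P_cyclically_reduced)
  next
    case False
    obtain a g' where g: "g = [a] @ g' @ [letter_inv a]" "g' \<noteq> []" "fg_reduced g'"
      using not_cyclically_reduced_decomp[OF less.prems False] by blast
    then have "hyperbolic_on P (rho_P \<rho> P g')" using less.hyps by simp
    then show ?thesis using hyperbolic_rho_P_conj[OF g(1) less.prems(1) g(3)] by blast
  qed
qed

end

theorem mainTheorem14:
  fixes \<rho> :: "('a::finite) fword \<Rightarrow> real^3^3"
    and P :: "(real^3) set"
    and S :: "'a fword set"
  assumes "CARD('a) \<ge> 2"
    and "fin_sym_gen_set S"
    and "reducible_suspension \<rho> P"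
    and "quasi_isometric S \<rho>"
  shows "\<forall>g\<in>fg_carrier. g \<noteq> [] \<longrightarrow> hyperbolic_on P (rho_P \<rho> P g)"
proof -
  have P: "subspace P" "dim P = 2" using assms(3) by (auto simp: reducible_suspension_def)
  obtain B where B: "B \<subseteq> P" "pairwise orthogonal B" "\<And>x. x \<in> B \<Longrightarrow> norm x = 1"
    "card B = dim P" "span B = P"
    using orthonormal_basis_subspace[OF P(1)] by metis
  obtain u1 u2 where u: "B = {u1, u2}" "u1 \<noteq> u2" using B(4) P(2) card_2_iff by metis
  interpret qi_suspension P u1 u2 \<rho> S
  proof unfold_locales
    show "u1 \<bullet> u2 = 0" using B(2) u by (auto simp: pairwise_def orthogonal_def)
  qed (use assms P B u in auto)
  show ?thesis using hyperbolic_rho_P by (simp add: fg_carrier_iff)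
qed

end
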